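(* Let $k\geq1$ and $n\geq k+1$ be integers, let $q\in(0,1)$ and $\psi=q^{k^2}$. For $i=1,2,3$ and $j\geq1$ let $\pi_i(j)=\mathbb{P}(\mathrm{Bin}(i+1,q^k)=j-1)$, and let $U$ be the compound Poisson random variable with parameters $$ \lambda_j=\frac{1}{j}\psi\left[4\pi_1(j)+4(n-k-1)\pi_2(j)+(n-k-1)^2\pi_3(j)\right],\qquad j=1,\ldots,5, $$ and $\lambda_j=0$ for $j\geq6$. If $q^k<1/4$, then $$ M_1^{(K)}(U)\leq\frac{1}{2\delta}\left[1+\log^+(\pi\delta)\right], $$ where $$ \delta=\psi\left[4a(q^k)+4(n-k-1)b(q^k)+(n-k-1)^2c(q^k)\right] $$ with $a(y)=(1-2y)^2$, $b(y)=(1-2y)^3$ and $c(y)=(1-4y)(1-4y+8y^2)$.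
   Context: Compound Poisson distribution: a compound Poisson random variable $U$ with parameters $\lambda_j\geq0$, $j\geq1$, $0<\lambda:=\sum_j\lambda_j<\infty$, is one equal in distribution to $\sum_{j=1}^N X_j$, where $N\sim\mathrm{Po}(\lambda)$ and $X_1,X_2,\ldots$ are i.i.d., independent of $N$, with $\mathbb{P}(X_1=j)=\lambda_j/\lambda$. Stein equation: let $\mathbb{Z}^+=\{0,1,2,\ldots\}$ and $\mathcal{H}_K=\{I(\cdot\leq y):y\in\mathbb{Z}^+\}$. For $h\in\mathcal{H}_K$, let $f_h$ be the bounded solution of $$h(x)-\mathbb{E}h(U)=\sum_{j=1}^\infty j\lambda_jf_h(x+j)-xf_h(x),\qquad x\in\mathbb{Z}^+;$$ this equation does not involve $f_h(0)$, and $f_h$ is considered on $\{1,2,\ldots\}$. Let $$M_1^{(K)}(U)=\sup_{h\in\mathcal{H}_K}\ \sup_{x\geq1}|f_h(x+1)-f_h(x)|.$$ $\mathrm{Bin}(m,r)$ denotes a binomial random variable with $m$ trials and success probability $r$; $\log^+$ is the positive part of the natural logarithm; in $\log^+(\pi\delta)$, $\pi$ is the usual constant. *)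

theory Defs
  imports "HOL-Probability.Probability"
begin

text \<open>
  The parameters \<open>\<lambda>\<^sub>j\<close>, \<open>j \<ge> 1\<close>, of a compound Poisson law are given by a function
  \<open>lam :: nat \<Rightarrow> real\<close>; the value \<open>lam 0\<close> is never used.
\<close>

definition cp_params :: "(nat \<Rightarrow> real) \<Rightarrow> bool" where
  "cp_params lam \<longleftrightarrow>
     (\<forall>j\<ge>1. lam j \<ge> 0) \<and> summable (\<lambda>j. lam (Suc j)) \<and> (\<Sum>j. lam (Suc j)) > 0"

definition cp_rate :: "(nat \<Rightarrow> real) \<Rightarrow> real" where
  "cp_rate lam = (\<Sum>j. lam (Suc j))"

definition cp_jump :: "(nat \<Rightarrow> real) \<Rightarrow> nat pmf" where
  "cp_jump lam = embed_pmf (\<lambda>j. if j = 0 then 0 else lam j / cp_rate lam)"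

text \<open>\<^const>\<open>embed_pmf\<close> is only meaningful for a genuine probability mass function.\<close>

lemma pmf_cp_jump:
  assumes "cp_params lam"
  shows "pmf (cp_jump lam) j = (if j = 0 then 0 else lam j / cp_rate lam)"
proof -
  let ?g = "\<lambda>j. if j = 0 then 0 else lam j / cp_rate lam"
  have nn: "lam (Suc i) \<ge> 0" for i
    using assms by (simp add: cp_params_def)
  have pos: "cp_rate lam > 0" and summ: "summable (\<lambda>j. lam (Suc j))"
    using assms by (simp_all add: cp_params_def cp_rate_def)
  have g_nn: "?g i \<ge> 0" for i
    using nn[of "i - 1"] pos by (cases i) auto
  have "(\<lambda>i. lam (Suc i) / cp_rate lam) sums (cp_rate lam / cp_rate lam)"
    unfolding cp_rate_def by (intro sums_divide summable_sums summ)
  hence "(\<lambda>i. ?g (Suc i)) sums 1"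
    using pos by simp
  hence g_sums: "?g sums 1"
    using sums_Suc_iff[of ?g 1] by simp
  have "(\<integral>\<^sup>+ i. ennreal (?g i) \<partial>count_space UNIV) = (\<Sum>i. ennreal (?g i))"
    by (rule nn_integral_count_space_nat)
  also have "\<dots> = ennreal (\<Sum>i. ?g i)"
    using g_nn g_sums by (intro suminf_ennreal2) (auto simp: sums_iff)
  also have "\<dots> = 1"
    using g_sums by (simp add: sums_iff)
  finally show ?thesis
    unfolding cp_jump_def using g_nn by (intro pmf_embed_pmf)
qed

text \<open>The law of \<open>X\<^sub>1 + \<dots> + X\<^sub>N\<close>, with \<open>N\<close> Poisson and the \<open>X\<^sub>i\<close> i.i.d. and independent of \<open>N\<close>.\<close>

definition compound_poisson_pmf :: "(nat \<Rightarrow> real) \<Rightarrow> nat pmf" where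
  "compound_poisson_pmf lam =
     do {N \<leftarrow> poisson_pmf (cp_rate lam);
         xs \<leftarrow> replicate_pmf N (cp_jump lam);
         return_pmf (sum_list xs)}"

definition H_K :: "(nat \<Rightarrow> real) set" where
  "H_K = {h. \<exists>y. h = (\<lambda>x. if x \<le> y then 1 else 0)}"

text \<open>
  In the series the index \<open>j = 0\<close> contributes \<open>0\<close>, so the sum is the one over \<open>j \<ge> 1\<close>.
\<close>

definition stein_equation :: "(nat \<Rightarrow> real) \<Rightarrow> (nat \<Rightarrow> real) \<Rightarrow> (nat \<Rightarrow> real) \<Rightarrow> bool" where
  "stein_equation lam h f \<longleftrightarrow>
     (\<forall>x. summable (\<lambda>j. real j * lam j * f (x + j)) \<and>
          h x - measure_pmf.expectation (compound_poisson_pmf lam) h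
            = (\<Sum>j. real j * lam j * f (x + j)) - real x * f x)"

text \<open>
  The equation leaves \<open>f 0\<close> free. Functions on \<open>{1,2,\<dots>}\<close> are represented by functions on
  \<^typ>\<open>nat\<close> with the dummy value \<open>f 0 = 0\<close>, without which the description would not be unique.
\<close>

definition stein_solution :: "(nat \<Rightarrow> real) \<Rightarrow> (nat \<Rightarrow> real) \<Rightarrow> nat \<Rightarrow> real" where
  "stein_solution lam h =
     (THE f. f 0 = 0 \<and> bounded (range f) \<and> stein_equation lam h f)"

text \<open>
  The suprema are taken in \<^typ>\<open>ereal\<close>, where they always exist.
\<close>

definition M1_K :: "(nat \<Rightarrow> real) \<Rightarrow> ereal" where
  "M1_K lam =
     (SUP h\<in>H_K. SUP x\<in>{1..}.
        ereal \<bar>stein_solution lam h (x + 1) - stein_solution lam h x\<bar>)"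

definition log_plus :: "real \<Rightarrow> real" where
  "log_plus x = max 0 (ln x)"

end

theory Submission
  imports Defs "HOL-Complex_Analysis.Complex_Analysis"
begin

text \<open>
  Write \<open>L z = (\<Sum>j. \<lambda>\<^sub>j (z\<^sup>j - 1))\<close>, so that \<open>exp \<circ> L\<close> is the probability generating function of \<open>U\<close>,
  and \<open>m = L'\<close>. For \<open>h = I(\<cdot> \<le> y)\<close> the value \<open>f\<^sub>h x\<close> is the coefficient of \<open>z\<^sup>y\<close> in an entire function
  \<open>K\<^bsub>x-1\<^esub> z\<close>, given by an integral over the segment from \<open>1\<close> to \<open>z\<close>: the Stein equation
  becomes \<open>(1 - z) ((\<Sum>j. j \<lambda>\<^sub>j K\<^bsub>x+j-1\<^esub> z) - x K\<^bsub>x-1\<^esub> z) = z\<^sup>x - exp (L z)\<close>, which is the fundamental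
  theorem of calculus on that segment. If \<open>Re ((1 - z) m(w)) \<ge> \<delta> Re (1 - z)\<close> for \<open>\<bar>z\<bar> = 1\<close> and \<open>w\<close> on the
  segment, then \<open>\<bar>K\<^bsub>x\<^esub> z - K\<^bsub>x-1\<^esub> z\<bar> \<le> \<bar>1 - z\<bar> / (1 + \<delta> Re (1 - z))\<close>, and integrating this over the unit circle by
  Cauchy's formula bounds \<open>f\<^sub>h (x + 1) - f\<^sub>h x\<close>. For the given parameters \<open>m(w)\<close> is a combination of
  powers of \<open>1 - q\<^sup>k (1 - w)\<close>, and the required inequality is one between polynomials in
  \<open>Re (1 - z) / 2\<close>.
\<close>

subsection \<open>The compound Poisson law and uniqueness in the Stein equation\<close>

lemma integral_pmf_atMost:
  assumes "\<And>i. i > n \<Longrightarrow> f i = 0"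
  shows "measure_pmf.expectation p (f :: nat \<Rightarrow> real) = (\<Sum>i\<le>n. pmf p i * f i)"
proof (subst integral_measure_pmf[of "{..n}"])
  show "a \<in> {..n}" if "f a \<noteq> 0" for a using assms[of a] that by force
qed simp_all

text \<open>Convolution of laws on the naturals is multiplication of generating functions:
  conditioning on the first summand produces a Cauchy product.\<close>

lemma pmf_map_sum_list_replicate:
  "pmf (map_pmf sum_list (replicate_pmf n p)) i = fps_nth (Abs_fps (pmf p) ^ n) i"
proof (induction n arbitrary: i)
  case 0
  then show ?case by (simp add: indicator_def)
next
  case (Suc n)
  let ?S = "map_pmf sum_list (replicate_pmf n p)"
  have eq: "map_pmf sum_list (replicate_pmf (Suc n) p) = bind_pmf p (\<lambda>x. map_pmf ((+) x) ?S)"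
    by (simp add: map_bind_pmf pmf.map_comp o_def map_pmf_def[symmetric])
  have inner: "pmf (map_pmf ((+) x) ?S) i = (if x \<le> i then pmf ?S (i - x) else 0)" for x
  proof (cases "x \<le> i")
    case True
    then show ?thesis using pmf_map_inj'[of "(+) x" ?S "i - x"] by simp
  next
    case False
    then show ?thesis by (auto simp: pmf_eq_0_set_pmf)
  qed
  have "pmf (map_pmf sum_list (replicate_pmf (Suc n) p)) i =
      measure_pmf.expectation p (\<lambda>x. if x \<le> i then pmf ?S (i - x) else 0)"
    unfolding eq pmf_bind inner ..
  also have "\<dots> = (\<Sum>x\<le>i. pmf p x * pmf ?S (i - x))"
    by (subst integral_pmf_atMost[where n = i]) auto
  also have "\<dots> = fps_nth (Abs_fps (pmf p) ^ Suc n) i"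
    by (simp add: fps_mult_nth Suc.IH atMost_atLeast0)
  finally show ?case .
qed

text \<open>Jumps are at least 1, so the \<open>n\<close>-th power of their generating function
  starts at order \<open>n\<close>. The Poisson mixture of \<open>i\<close>-th coefficients is
  therefore a finite sum over \<open>n \<le> i\<close>, which is exactly a coefficient of
  \<open>fps_compose\<close>.\<close>

lemma pmf_compound_poisson:
  assumes "cp_params lam"
  shows "pmf (compound_poisson_pmf lam) i =
    exp (- cp_rate lam) * fps_nth (fps_compose (fps_exp (cp_rate lam)) (Abs_fps (pmf (cp_jump lam)))) i"
proof -
  let ?p = "Abs_fps (pmf (cp_jump lam))"
  have pos: "cp_rate lam > 0" using assms by (simp add: cp_params_def cp_rate_def)
  have p0: "fps_nth ?p 0 = 0" by (simp add: pmf_cp_jump[OF assms])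
  have "pmf (compound_poisson_pmf lam) i =
      measure_pmf.expectation (poisson_pmf (cp_rate lam)) (\<lambda>n. fps_nth (?p ^ n) i)"
    unfolding compound_poisson_pmf_def pmf_bind map_pmf_def[symmetric] pmf_map_sum_list_replicate ..
  also have "\<dots> = (\<Sum>n\<le>i. pmf (poisson_pmf (cp_rate lam)) n * fps_nth (?p ^ n) i)"
    using startsby_zero_power_prefix[OF p0] by (intro integral_pmf_atMost) auto
  also have "\<dots> = exp (- cp_rate lam) * fps_nth (fps_compose (fps_exp (cp_rate lam)) ?p) i"
    by (simp add: fps_compose_nth pmf_poisson[OF pos] sum_distrib_left atMost_atLeast0 mult_ac)
  finally show ?thesis .
qed

text \<open>The difference \<open>d\<close> of two solutions solves the homogeneous equation, so
  \<open>d x\<close> is controlled by later values with the factor \<open>C / x\<close>. Far out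
  this factor is at most 1/2, and iterating it on the bounded \<open>d\<close> forces
  \<open>d = 0\<close> there; the equation then carries the zeros down to 1.\<close>

lemma stein_equation_unique:
  assumes supp: "\<And>j. j > J \<Longrightarrow> lam j = 0"
    and f: "bounded (range f)" "stein_equation lam h f"
    and g: "bounded (range g)" "stein_equation lam h g"
    and "x \<ge> 1"
  shows "f x = g x"
proof -
  define d where "d x = f x - g x" for x
  define C where "C = (\<Sum>j\<le>J. \<bar>real j * lam j\<bar>)"
  obtain A B where A: "\<And>x. \<bar>f x\<bar> \<le> A" and B: "\<And>x. \<bar>g x\<bar> \<le> B"
    using f(1) g(1) by (auto simp: bounded_iff)
  have fin: "(\<Sum>j. real j * lam j * e (x + j)) = (\<Sum>j\<le>J. real j * lam j * e (x + j))" for e x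
    by (intro suminf_finite) (auto simp: supp)
  have eq: "real x * d x = (\<Sum>j\<le>J. real j * lam j * d (x + j))" for x
  proof -
    have "(\<Sum>j\<le>J. real j * lam j * f (x + j)) - real x * f x =
        (\<Sum>j\<le>J. real j * lam j * g (x + j)) - real x * g x"
      using f(2) g(2) by (simp add: stein_equation_def fin)
    then show ?thesis
      by (simp add: d_def algebra_simps sum_subtractf)
  qed
  have C0: "C \<ge> 0" unfolding C_def by (simp add: sum_nonneg)
  \<comment> \<open>Only arguments strictly beyond \<open>x\<close> need a bound, since the term
    \<open>j = 0\<close> carries the factor \<open>real j\<close>.\<close>
  have step: "\<bar>d x\<bar> \<le> C * D / real x" if "x \<ge> 1" and D: "\<And>y. y > x \<Longrightarrow> \<bar>d y\<bar> \<le> D" for x D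
  proof -
    have "real x * \<bar>d x\<bar> = \<bar>\<Sum>j\<le>J. real j * lam j * d (x + j)\<bar>"
      using eq[of x] by (metis abs_mult abs_of_nat)
    also have "\<dots> \<le> (\<Sum>j\<le>J. \<bar>real j * lam j\<bar> * D)"
    proof (rule sum_abs[THEN order_trans], rule sum_mono)
      fix j
      show "\<bar>real j * lam j * d (x + j)\<bar> \<le> \<bar>real j * lam j\<bar> * D"
        using D[of "x + j"] by (cases "j = 0") (auto simp: abs_mult intro!: mult_left_mono)
    qed
    also have "\<dots> = C * D" by (simp add: C_def sum_distrib_right)
    finally show ?thesis using that(1) by (simp add: field_simps)
  qed
  obtain X :: nat where X: "real X \<ge> 2 * C + 1" using real_arch_simple by blast
  have halve: "\<bar>d x\<bar> \<le> (A + B) * (1 / 2) ^ m" if "x \<ge> X" for m x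
    using that
  proof (induction m arbitrary: x)
    case 0
    then show ?case using A[of x] B[of x] by (simp add: d_def)
  next
    case (Suc m)
    have AB: "0 \<le> A + B" using A[of 0] B[of 0] by linarith
    have x: "real x \<ge> 2 * C + 1" using Suc.prems X by linarith
    have "\<bar>d x\<bar> \<le> C * ((A + B) * (1 / 2) ^ m) / real x"
      using x C0 Suc by (intro step) auto
    also have "\<dots> = (C / real x) * ((A + B) * (1 / 2) ^ m)" by simp
    also have "\<dots> \<le> (1 / 2) * ((A + B) * (1 / 2) ^ m)"
      using x C0 AB by (intro mult_right_mono) (auto simp: field_simps)
    finally show ?case by simp
  qed
  have "d x = 0" if "x \<ge> X" for x
  proof -
    have "(\<lambda>m. (A + B) * (1 / 2) ^ m) \<longlonglongrightarrow> (A + B) * 0"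
      by (intro tendsto_intros) auto
    then have "\<bar>d x\<bar> \<le> 0"
      using LIMSEQ_le_const[of _ 0 "\<bar>d x\<bar>"] halve[OF that] by auto
    then show ?thesis by simp
  qed
  then have "d y = 0" if "y \<ge> 1" "y + i \<ge> X" for i y
    using that
  proof (induction i arbitrary: y)
    case (Suc i)
    then have "\<bar>d z\<bar> \<le> 0" if "z > y" for z using that by simp
    then show ?case using step[of y 0] Suc.prems by simp
  qed simp
  from this[of x X] show ?thesis using assms(6) by (simp add: d_def)
qed

subsection \<open>The Stein kernel\<close>

text \<open>Cauchy's coefficient formula on the unit circle, where powers of \<open>z\<close> have
  modulus 1, so one bound serves every \<open>n\<close>. The majorant may depend on the angle
  because the one for kernel differences varies along the circle.\<close>

lemma norm_fps_expansion_le: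
  assumes f: "f holomorphic_on UNIV"
    and le: "\<And>t. t \<in> {0..2 * pi} \<Longrightarrow> cmod (f (cis t)) \<le> g t"
    and g: "(g has_integral I) {0..2 * pi}"
  shows "cmod (fps_nth (fps_expansion f 0) n) \<le> I / (2 * pi)"
proof -
  let ?d = "(deriv ^^ n) f 0"
  have "((\<lambda>u. f u / (u - 0) ^ Suc n) has_contour_integral (2 * pi * \<i>) / fact n * ?d) (circlepath 0 1)"
    using f by (intro Cauchy_has_contour_integral_higher_derivative_circlepath)
      (auto intro: holomorphic_on_subset holomorphic_on_imp_continuous_on)
  then have int: "((\<lambda>t. f (cis t) / cis t ^ Suc n * \<i> * cis t) has_integral (2 * pi * \<i>) / fact n * ?d) {0..2 * pi}"
    unfolding circlepath_def by (subst (asm) has_contour_integral_part_circlepath_iff) (auto simp: algebra_simps)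
  have "cmod (integral {0..2 * pi} (\<lambda>t. f (cis t) / cis t ^ Suc n * \<i> * cis t)) \<le> integral {0..2 * pi} g"
    using le by (intro integral_norm_bound_integral has_integral_integrable[OF int] has_integral_integrable[OF g])
      (auto simp: norm_mult norm_divide norm_power)
  then have "cmod ((2 * pi * \<i>) / fact n * ?d) \<le> I"
    unfolding integral_unique[OF int] integral_unique[OF g] .
  then show ?thesis
    by (simp add: fps_expansion_def norm_mult norm_divide field_simps)
qed

text \<open>This is \<open>L\<close> of the overview, and \<open>cp_drift\<close> is
  \<open>m\<close>. The cutoff \<open>J\<close> makes both polynomials; the lemmas that speak of the
  law of \<open>U\<close> assume that \<open>lam\<close> vanishes beyond it.\<close>

definition cp_exponent :: "(nat \<Rightarrow> real) \<Rightarrow> nat \<Rightarrow> complex \<Rightarrow> complex" where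
  "cp_exponent lam J z = (\<Sum>j=1..J. of_real (lam j) * (z ^ j - 1))"

definition cp_drift :: "(nat \<Rightarrow> real) \<Rightarrow> nat \<Rightarrow> complex \<Rightarrow> complex" where
  "cp_drift lam J z = (\<Sum>j=1..J. of_real (real j * lam j) * z ^ (j - 1))"

definition thinned :: "real \<Rightarrow> complex \<Rightarrow> complex" where
  "thinned r z = 1 - of_real r * (1 - z)"

definition stein_integrand :: "(nat \<Rightarrow> real) \<Rightarrow> nat \<Rightarrow> nat \<Rightarrow> complex \<Rightarrow> complex" where
  "stein_integrand lam J m w = w ^ m * exp (- cp_exponent lam J w)"

text \<open>
  With \<open>r = exp (- t)\<close> this is the time integral in Barbour's generator approach, after taking generating
  functions: individuals of an immigration-death process survive up to time \<open>t\<close> with probability \<open>r\<close>,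
  which replaces \<open>z\<close> by \<open>thinned r z\<close>.
\<close>

definition stein_kernel :: "(nat \<Rightarrow> real) \<Rightarrow> nat \<Rightarrow> nat \<Rightarrow> complex \<Rightarrow> complex" where
  "stein_kernel lam J m z =
     exp (cp_exponent lam J z) * integral {0..1} (\<lambda>r. stein_integrand lam J m (thinned r z))"

lemma DERIV_cp_exponent [derivative_intros]:
  assumes "(f has_field_derivative D) (at z within S)"
  shows "((\<lambda>z. cp_exponent lam J (f z)) has_field_derivative (cp_drift lam J (f z) * D)) (at z within S)"
  unfolding cp_exponent_def cp_drift_def
  by (auto intro!: derivative_eq_intros assms sum.cong simp: sum_distrib_left sum_distrib_right mult_ac)

lemma continuous_on_cp_exponent [continuous_intros]:
  "continuous_on S f \<Longrightarrow> continuous_on S (\<lambda>z. cp_exponent lam J (f z))"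
  unfolding cp_exponent_def by (intro continuous_intros)

lemma continuous_on_cp_drift [continuous_intros]:
  "continuous_on S f \<Longrightarrow> continuous_on S (\<lambda>z. cp_drift lam J (f z))"
  unfolding cp_drift_def by (intro continuous_intros)

lemma continuous_on_thinned [continuous_intros]:
  "continuous_on S f \<Longrightarrow> continuous_on S g \<Longrightarrow> continuous_on S (\<lambda>x. thinned (f x) (g x))"
  unfolding thinned_def by (intro continuous_intros)

lemma DERIV_stein_integrand [derivative_intros]:
  assumes "(f has_field_derivative D) (at z within S)"
  shows "((\<lambda>z. stein_integrand lam J m (f z)) has_field_derivative
    ((of_nat m * f z ^ (m - 1) - f z ^ m * cp_drift lam J (f z)) * exp (- cp_exponent lam J (f z)) * D))
    (at z within S)"
  unfolding stein_integrand_def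
  by (auto intro!: derivative_eq_intros assms simp: algebra_simps)

lemma continuous_on_stein_integrand [continuous_intros]:
  "continuous_on S f \<Longrightarrow> continuous_on S (\<lambda>z. stein_integrand lam J m (f z))"
  unfolding stein_integrand_def by (intro continuous_intros)

lemma DERIV_thinned:
  "((\<lambda>z. thinned r z) has_field_derivative of_real r) (at z within S)"
  unfolding thinned_def by (auto intro!: derivative_eq_intros)

lemma norm_thinned_le:
  assumes "cmod z \<le> 1" "0 \<le> r" "r \<le> 1"
  shows "cmod (thinned r z) \<le> 1"
proof -
  have "cmod (thinned r z) \<le> norm (of_real (1 - r) :: complex) + norm (of_real r * z)"
    unfolding thinned_def by (rule order_trans[OF eq_refl norm_triangle_ineq]) (simp add: algebra_simps)
  also have "\<dots> \<le> (1 - r) + r * 1"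
    unfolding norm_mult norm_of_real using assms by (intro add_mono mult_mono) auto
  finally show ?thesis by simp
qed

lemma stein_integrand_integrable: "(\<lambda>r. stein_integrand lam J m (thinned r z)) integrable_on {0..1}"
  by (intro integrable_continuous_real continuous_intros)

lemma stein_kernel_holomorphic: "stein_kernel lam J m holomorphic_on UNIV"
proof -
  have "(\<lambda>z. integral (cbox 0 1) (\<lambda>r. stein_integrand lam J m (thinned r z))) holomorphic_on UNIV"
  proof (rule leibniz_rule_holomorphic)
    fix z :: complex and r :: real
    show "((\<lambda>z. stein_integrand lam J m (thinned r z)) has_field_derivative
        (of_nat m * thinned r z ^ (m - 1) - thinned r z ^ m * cp_drift lam J (thinned r z)) *
          exp (- cp_exponent lam J (thinned r z)) * of_real r) (at z within UNIV)"
      by (intro derivative_intros DERIV_thinned)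
  qed (use stein_integrand_integrable in \<open>auto simp: case_prod_unfold intro!: continuous_intros\<close>)
  moreover have "(\<lambda>z. exp (cp_exponent lam J z)) holomorphic_on UNIV"
    unfolding cp_exponent_def by (intro holomorphic_intros)
  ultimately show ?thesis
    unfolding stein_kernel_def by (auto intro: holomorphic_on_mult)
qed

text \<open>Along the segment, \<open>w^x exp (- L w)\<close> has as its \<open>r\<close>-derivative
  the integrand of the bracket times \<open>1 - z\<close>, without the prefactor
  \<open>exp (L z)\<close>. At \<open>r = 0\<close> it equals 1 because \<open>L 1 = 0\<close>;
  multiplying the endpoint difference by \<open>exp (L z)\<close> gives the right-hand side. For
  \<open>x = 0\<close> the truncated index \<open>x - 1\<close> occurs only with coefficient
  0.\<close>

lemma stein_kernel_identity:
  "(1 - z) * ((\<Sum>j=1..J. of_real (real j * lam j) * stein_kernel lam J (x + j - 1) z)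
      - of_nat x * stein_kernel lam J (x - 1) z)
    = z ^ x - exp (cp_exponent lam J z)"
proof -
  let ?L = "cp_exponent lam J"
  let ?F = "\<lambda>m r. stein_integrand lam J m (thinned r z)"
  let ?T = "\<lambda>m. integral {0..1} (?F m)"
  have T: "(?F m has_integral ?T m) {0..1}" for m
    by (intro integrable_integral stein_integrand_integrable)
  have "((\<lambda>r. (1 - z) * ((\<Sum>j=1..J. of_real (real j * lam j) * ?F (x + j - 1) r) - of_nat x * ?F (x - 1) r))
      has_integral (1 - z) * ((\<Sum>j=1..J. of_real (real j * lam j) * ?T (x + j - 1)) - of_nat x * ?T (x - 1))) {0..1}"
    by (intro has_integral_mult_right has_integral_diff has_integral_sum T) auto
  moreover have "((\<lambda>r. (1 - z) * ((\<Sum>j=1..J. of_real (real j * lam j) * ?F (x + j - 1) r) - of_nat x * ?F (x - 1) r))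
      has_integral ?F x 1 - ?F x 0) {0..1}"
  proof (rule fundamental_theorem_of_calculus)
    fix r :: real
    let ?w = "thinned r z"
    have sum: "(\<Sum>j=1..J. of_real (real j * lam j) * ?F (x + j - 1) r) =
        ?w ^ x * cp_drift lam J ?w * exp (- ?L ?w)"
      unfolding cp_drift_def stein_integrand_def sum_distrib_left sum_distrib_right
      by (intro sum.cong) (auto simp: power_add[symmetric] mult_ac)
    have "((\<lambda>s. 1 - s * (1 - z)) has_field_derivative - (1 - z)) (at (of_real r))"
      by (auto intro!: derivative_eq_intros)
    from DERIV_stein_integrand[OF this, of lam J x]
    have "((\<lambda>s. stein_integrand lam J x (1 - s * (1 - z))) has_field_derivative
      (of_nat x * ?w ^ (x - 1) - ?w ^ x * cp_drift lam J ?w) * exp (- ?L ?w) * - (1 - z)) (at (of_real r))"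
      by (simp add: thinned_def)
    from has_vector_derivative_real_field[OF this]
    show "(?F x has_vector_derivative
      (1 - z) * ((\<Sum>j=1..J. of_real (real j * lam j) * ?F (x + j - 1) r) - of_nat x * ?F (x - 1) r)) (at r within {0..1})"
      unfolding sum by (simp add: thinned_def stein_integrand_def algebra_simps)
  qed simp
  ultimately have "(1 - z) * ((\<Sum>j=1..J. of_real (real j * lam j) * ?T (x + j - 1)) - of_nat x * ?T (x - 1))
      = z ^ x * exp (- ?L z) - 1"
    by (subst has_integral_unique) (auto simp: thinned_def stein_integrand_def cp_exponent_def)
  then have "exp (?L z) * ((1 - z) * ((\<Sum>j=1..J. of_real (real j * lam j) * ?T (x + j - 1)) - of_nat x * ?T (x - 1)))
      = z ^ x - exp (?L z)"
    by (simp add: exp_minus field_simps)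
  then show ?thesis
    by (simp add: stein_kernel_def sum_distrib_left algebra_simps)
qed

text \<open>Division by \<open>1 - X\<close> forms partial sums of coefficients. It turns
  \<open>z^x\<close> into the indicator of \<open>x \<le> y\<close> and the generating function of
  \<open>U\<close> into its distribution function.\<close>

lemma fps_nth_divide_1_minus_X:
  fixes F G :: "'a :: field fps"
  assumes "(1 - fps_X) * F = G"
  shows "fps_nth F n = (\<Sum>i\<le>n. fps_nth G i)"
proof (induction n)
  case 0
  show ?case using arg_cong[OF assms, of "\<lambda>A. fps_nth A 0"] by (simp add: algebra_simps)
next
  case (Suc n)
  then show ?case using arg_cong[OF assms, of "\<lambda>A. fps_nth A (Suc n)"]
    by (simp add: algebra_simps)
qed

text \<open>Integrating the drift bound along the segment from \<open>thinned r z\<close> to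
  \<open>z\<close> yields exponential decay in \<open>1 - r\<close>.\<close>

lemma Re_cp_exponent_thinned:
  assumes dom: "\<And>s. 0 \<le> s \<Longrightarrow> s \<le> 1 \<Longrightarrow> \<delta> * Re (1 - z) \<le> Re ((1 - z) * cp_drift lam J (thinned s z))"
    and r: "0 \<le> r" "r \<le> 1"
  shows "Re (cp_exponent lam J z) - Re (cp_exponent lam J (thinned r z)) \<le> - \<delta> * Re (1 - z) * (1 - r)"
proof -
  \<comment> \<open>The linear term compensates the guaranteed rate of decrease, so the claim
    becomes monotonicity of \<open>\<phi>\<close>.\<close>
  define \<phi> where "\<phi> s = Re (cp_exponent lam J (thinned s z)) + \<delta> * Re (1 - z) * s" for s
  have "\<phi> 1 \<le> \<phi> r"
  proof (rule DERIV_nonpos_imp_nonincreasing[where f = \<phi> and a = r and b = 1])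
    fix s assume s: "r \<le> s" "s \<le> 1"
    have "((\<lambda>s. 1 - s * (1 - z)) has_field_derivative - (1 - z)) (at (of_real s))"
      by (auto intro!: derivative_eq_intros)
    from DERIV_cp_exponent[OF this, of lam J]
    have "((\<lambda>s. cp_exponent lam J (1 - s * (1 - z))) has_field_derivative
      - ((1 - z) * cp_drift lam J (thinned s z))) (at (of_real s))"
      by (simp add: thinned_def algebra_simps)
    from has_vector_derivative_real_field[OF this]
    have "((\<lambda>s. cp_exponent lam J (thinned s z)) has_vector_derivative
      - ((1 - z) * cp_drift lam J (thinned s z))) (at s)"
      by (simp add: thinned_def)
    then have "((\<lambda>s. Re (cp_exponent lam J (thinned s z))) has_real_derivative
      - Re ((1 - z) * cp_drift lam J (thinned s z))) (at s)"
      by (simp add: has_vector_derivative_complex_iff)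
    then have "(\<phi> has_real_derivative - Re ((1 - z) * cp_drift lam J (thinned s z)) + \<delta> * Re (1 - z)) (at s)"
      using DERIV_add[OF _ DERIV_cmult_Id] unfolding \<phi>_def by blast
    then show "\<exists>y. (\<phi> has_real_derivative y) (at s) \<and> y \<le> 0"
      using dom[of s] s r by (intro exI conjI) auto
  qed (use r in auto)
  then show ?thesis by (simp add: \<phi>_def thinned_def algebra_simps)
qed

text \<open>With \<open>w = thinned r z\<close>, \<open>w^(m+1) - w^m = - r (1 - z) w^m\<close> and
  \<open>w\<close> stays in the unit disc. The exponential factor is at most
  \<open>exp (- \<kappa> (1 - r))\<close>, and the integral of \<open>r\<close> times this over
  \<open>{0..1}\<close> is at most \<open>1 / (1 + \<kappa>)\<close>.\<close>

lemma stein_kernel_diff_le: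
  assumes z: "cmod z = 1" and "0 \<le> \<delta>"
    and dom: "\<And>s. 0 \<le> s \<Longrightarrow> s \<le> 1 \<Longrightarrow> \<delta> * Re (1 - z) \<le> Re ((1 - z) * cp_drift lam J (thinned s z))"
  shows "cmod (stein_kernel lam J (Suc m) z - stein_kernel lam J m z) \<le> cmod (1 - z) / (1 + \<delta> * Re (1 - z))"
proof -
  let ?L = "cp_exponent lam J"
  let ?F = "\<lambda>m r. stein_integrand lam J m (thinned r z)"
  define \<kappa> where "\<kappa> = \<delta> * Re (1 - z)"
  have "Re z \<le> 1" using complex_Re_le_cmod[of z] z by simp
  then have \<kappa>: "\<kappa> \<ge> 0" using \<open>0 \<le> \<delta>\<close> by (simp add: \<kappa>_def)
  text \<open>\<open>\<Phi>\<close> is a primitive of a majorant of \<open>r exp (- \<kappa> (1 - r))\<close>,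
    chosen so that \<open>\<kappa> = 0\<close> needs no separate treatment.\<close>
  define \<Phi> where "\<Phi> r = 1 / (1 + \<kappa>) * (r * exp (- \<kappa> * (1 - r)))" for r
  define \<Phi>' where "\<Phi>' r = 1 / (1 + \<kappa>) * ((1 + \<kappa> * r) * exp (- \<kappa> * (1 - r)))" for r
  have \<Phi>: "(\<Phi>' has_integral \<Phi> 1 - \<Phi> 0) {0..1}"
  proof (rule fundamental_theorem_of_calculus)
    fix r :: real
    have "((\<lambda>r. r * exp (- \<kappa> * (1 - r))) has_real_derivative (1 + \<kappa> * r) * exp (- \<kappa> * (1 - r)))
      (at r within {0..1})"
      by (auto intro!: derivative_eq_intros simp: algebra_simps)
    from DERIV_cmult[OF this]
    show "(\<Phi> has_vector_derivative \<Phi>' r) (at r within {0..1})"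
      unfolding \<Phi>_def \<Phi>'_def has_real_derivative_iff_has_vector_derivative[symmetric] .
  qed simp
  have *: "stein_kernel lam J (Suc m) z - stein_kernel lam J m z =
      integral {0..1} (\<lambda>r. exp (?L z) * (?F (Suc m) r - ?F m r))"
    by (simp add: stein_kernel_def integral_diff stein_integrand_integrable right_diff_distrib)
  have "cmod (integral {0..1} (\<lambda>r. exp (?L z) * (?F (Suc m) r - ?F m r))) \<le>
      integral {0..1} (\<lambda>r. cmod (1 - z) * \<Phi>' r)"
  proof (rule integral_norm_bound_integral)
    show "(\<lambda>r. exp (?L z) * (?F (Suc m) r - ?F m r)) integrable_on {0..1}"
      by (intro integrable_continuous_real continuous_intros)
    show "(\<lambda>r. cmod (1 - z) * \<Phi>' r) integrable_on {0..1}"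
      using has_integral_integrable[OF has_integral_mult_right[OF \<Phi>]] .
    fix r :: real assume r: "r \<in> {0..1}"
    let ?w = "thinned r z"
    have w: "cmod ?w ^ m \<le> 1"
      using norm_thinned_le[of z r] r z by (simp add: power_le_one)
    have "exp (?L z) * (?F (Suc m) r - ?F m r) = - (of_real r * (1 - z) * ?w ^ m * exp (?L z - ?L ?w))"
      by (simp add: stein_integrand_def thinned_def exp_diff exp_minus field_simps)
    then have "cmod (exp (?L z) * (?F (Suc m) r - ?F m r)) =
        r * cmod (1 - z) * cmod ?w ^ m * exp (Re (?L z) - Re (?L ?w))"
      using r by (simp add: norm_mult norm_power)
    also have "\<dots> \<le> r * cmod (1 - z) * 1 * exp (- \<kappa> * (1 - r))"
      using w r Re_cp_exponent_thinned[OF dom, of r] unfolding \<kappa>_def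
      by (intro mult_mono mult_nonneg_nonneg) auto
    also have "\<dots> = cmod (1 - z) * (r * exp (- \<kappa> * (1 - r)))" by simp
    also have "r * exp (- \<kappa> * (1 - r)) \<le> \<Phi>' r"
    proof -
      have "r * (1 + \<kappa>) \<le> 1 + \<kappa> * r" using r by (simp add: algebra_simps)
      then show ?thesis unfolding \<Phi>'_def using \<kappa> by (simp add: field_simps)
    qed
    finally show "cmod (exp (?L z) * (?F (Suc m) r - ?F m r)) \<le> cmod (1 - z) * \<Phi>' r"
      by (simp add: mult_left_mono)
  qed
  also have "\<dots> = cmod (1 - z) * (\<Phi> 1 - \<Phi> 0)"
    using \<Phi> by (simp add: integral_unique)
  finally show ?thesis unfolding * by (simp add: \<Phi>_def \<kappa>_def)
qed

text \<open>The powers \<open>w^m\<close> are at most 1 in modulus on the closed disc, so the bound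
  is uniform in \<open>m\<close>; this makes the constructed solution bounded in
  \<open>x\<close>.\<close>

lemma stein_kernel_bounded:
  "\<exists>C. \<forall>m z. cmod z = 1 \<longrightarrow> cmod (stein_kernel lam J m z) \<le> C"
proof -
  have "compact (cp_exponent lam J ` cball 0 1)"
    by (intro compact_continuous_image continuous_intros) auto
  then obtain B where B: "\<And>z. cmod z \<le> 1 \<Longrightarrow> cmod (cp_exponent lam J z) \<le> B"
    by (metis (no_types, lifting) bounded_iff compact_imp_bounded image_eqI mem_cball_0)
  have "cmod (stein_kernel lam J m z) \<le> exp B * exp B" if z: "cmod z = 1" for m z
  proof -
    have "cmod (integral {0..1} (\<lambda>r. stein_integrand lam J m (thinned r z))) \<le> integral {0..1} (\<lambda>r::real. exp B)"
    proof (intro integral_norm_bound_integral stein_integrand_integrable)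
      fix r :: real assume r: "r \<in> {0..1}"
      then have w: "cmod (thinned r z) \<le> 1"
        using z by (intro norm_thinned_le) auto
      then have "cmod (thinned r z) ^ m * exp (- Re (cp_exponent lam J (thinned r z))) \<le> 1 * exp B"
        using B[OF w] abs_Re_le_cmod[of "cp_exponent lam J (thinned r z)"]
        by (intro mult_mono) (auto simp: power_le_one)
      then show "cmod (stein_integrand lam J m (thinned r z)) \<le> exp B"
        by (simp add: stein_integrand_def norm_mult norm_power)
    qed auto
    moreover have "Re (cp_exponent lam J z) \<le> B"
      using B[of z] z complex_Re_le_cmod[of "cp_exponent lam J z"] by simp
    ultimately show ?thesis
      unfolding stein_kernel_def norm_mult by (intro mult_mono) auto
  qed
  then show ?thesis by blast
qed

subsection \<open>The integral over the unit circle\<close>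

text \<open>The quadratic Taylor bound at 1/4 is \<open>1 + 1/4 + 1/32 = 1.28125\<close>, and its
  sixth power exceeds 4.4.\<close>

lemma exp_3_2_ge: "4.4 \<le> exp (3 / 2 :: real)"
proof -
  have "(1.28125 :: real) ^ 6 \<le> exp (1 / 4) ^ 6"
    using exp_lower_Taylor_quadratic[of "1 / 4 :: real"] by (intro power_mono) (auto simp: power2_eq_square)
  also have "exp (1 / 4) ^ 6 = exp (3 / 2 :: real)"
    by (simp add: exp_of_nat_mult[symmetric])
  finally show ?thesis by (simp add: numeral_eq_Suc)
qed

text \<open>Since \<open>pi * \<beta> \<ge> 3\<close>, the prefactor is at most 2/3, and it suffices
  to bound the difference of logarithms by \<open>3/2 + log_plus (pi * \<delta>)\<close>. As
  \<open>\<beta>\<^sup>2 - 1 = 1 / (2 * \<delta>)\<close>, the ratio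
  \<open>(\<beta> + 1) / (\<beta> - 1)\<close> is \<open>pi * \<delta>\<close> times
  \<open>2 / pi * (\<beta> + 1)\<^sup>2\<close>.\<close>

lemma kolmogorov_constant_bound:
  fixes \<delta> \<beta> :: real
  assumes \<delta>: "\<delta> > 0" and \<beta>: "\<beta> > 1" "\<beta>\<^sup>2 = 1 + 1 / (2 * \<delta>)"
  shows "2 / (pi * \<beta>) * (ln (\<beta> + 1) - ln (\<beta> - 1)) \<le> 1 + log_plus (pi * \<delta>)"
proof -
  have pi: "3.14 \<le> pi" "pi \<le> 3.15" using pi_approx by auto
  have main: "2 / (pi * \<beta>) * X \<le> 1 + Y" if "0 \<le> Y" "X \<le> 3 / 2 + Y" for X Y
  proof -
    have "2 / (pi * \<beta>) * X \<le> 2 / (pi * \<beta>) * (3 / 2 + Y)"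
      using \<beta> that by (intro mult_left_mono) auto
    also have "\<dots> \<le> 2 / 3 * (3 / 2 + Y)"
    proof (intro mult_right_mono)
      have "3 * 1 \<le> pi * \<beta>" using pi \<beta> by (intro mult_mono) auto
      then show "2 / (pi * \<beta>) \<le> 2 / 3" by (simp add: field_simps)
    qed (use that in auto)
    also have "\<dots> \<le> 1 + Y" using that by simp
    finally show ?thesis .
  qed
  show ?thesis
  proof (rule main)
    show "0 \<le> log_plus (pi * \<delta>)" by (simp add: log_plus_def)
    have ln_le: "ln x \<le> 3 / 2" if "0 < x" "x \<le> 4.4" for x :: real
      using that exp_3_2_ge by (metis ln_exp ln_le_cancel_iff exp_gt_zero order_trans)
    show "ln (\<beta> + 1) - ln (\<beta> - 1) \<le> 3 / 2 + log_plus (pi * \<delta>)"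
    proof (cases "pi * \<delta> \<ge> 1")
      case True
      \<comment> \<open>The threshold \<open>pi * \<delta> = 1\<close> corresponds to
        \<open>\<beta>\<^sup>2 = 1 + pi / 2\<close>, which lies between \<open>1.6\<^sup>2\<close>
        and \<open>1.605\<^sup>2\<close>. Here \<open>\<beta>\<close> is below it, in the other case
        above it.\<close>
      have "1 / (2 * \<delta>) \<le> pi / 2" using True \<delta> by (simp add: field_simps)
      then have "\<beta>\<^sup>2 \<le> 1.605\<^sup>2" using \<beta> pi by (simp add: power2_eq_square)
      then have "\<beta> \<le> 1.605" by (rule power2_le_imp_le) simp
      then have "(\<beta> + 1)\<^sup>2 \<le> 2.605\<^sup>2" using \<beta> by (intro power_mono) auto
      then have "2 / pi * (\<beta> + 1)\<^sup>2 \<le> 2 / 3.14 * 2.605\<^sup>2" using pi by (intro mult_mono divide_left_mono) auto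
      then have le: "2 / pi * (\<beta> + 1)\<^sup>2 \<le> 4.4" by (simp add: power2_eq_square)
      have "(\<beta> + 1) * (\<beta> - 1) * (2 * \<delta>) = 1"
        using \<beta> \<delta> by (simp add: power2_eq_square field_simps)
      then have "(\<beta> + 1) / (\<beta> - 1) = (\<beta> + 1) * ((\<beta> + 1) * (\<beta> - 1) * (2 * \<delta>)) / (\<beta> - 1)"
        by simp
      also have "\<dots> = (pi * \<delta>) * (2 / pi * (\<beta> + 1)\<^sup>2)"
        using \<beta> by (simp add: power2_eq_square)
      finally have ratio: "(\<beta> + 1) / (\<beta> - 1) = (pi * \<delta>) * (2 / pi * (\<beta> + 1)\<^sup>2)" .
      have "ln (\<beta> + 1) - ln (\<beta> - 1) = ln ((pi * \<delta>) * (2 / pi * (\<beta> + 1)\<^sup>2))"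
        unfolding ratio[symmetric] using \<beta> by (simp add: ln_div)
      also have "\<dots> = ln (pi * \<delta>) + ln (2 / pi * (\<beta> + 1)\<^sup>2)"
        using \<beta> \<delta> by (intro ln_mult_pos) auto
      also have "ln (2 / pi * (\<beta> + 1)\<^sup>2) \<le> 3 / 2"
        using \<beta> le by (intro ln_le) auto
      finally show ?thesis by (simp add: log_plus_def)
    next
      case False
      have "pi / 2 \<le> 1 / (2 * \<delta>)" using False \<delta> by (simp add: field_simps)
      then have "1.6\<^sup>2 \<le> \<beta>\<^sup>2" using \<beta> pi by (simp add: power2_eq_square)
      then have b: "1.6 \<le> \<beta>" using \<beta> by (intro power2_le_imp_le[of "1.6" \<beta>]) auto
      have "ln (\<beta> + 1) - ln (\<beta> - 1) = ln ((\<beta> + 1) / (\<beta> - 1))"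
        using \<beta> by (simp add: ln_div)
      also have "\<dots> \<le> 3 / 2" using b by (intro ln_le) (auto simp: field_simps)
      finally show ?thesis by (simp add: log_plus_def)
    qed
  qed
qed

text \<open>By half-angle formulas the numerator is \<open>2 sin (t/2)\<close> and the denominator
  \<open>2 \<delta> (\<beta>\<^sup>2 - cos\<^sup>2 (t/2))\<close>. Substituting
  \<open>cos (t/2)\<close> and splitting into partial fractions gives the logarithmic primitive
  \<open>G\<close>.\<close>

lemma has_integral_circle:
  fixes \<delta> :: real
  assumes \<delta>: "\<delta> > 0"
  defines "\<beta> \<equiv> sqrt (1 + 1 / (2 * \<delta>))"
  shows "((\<lambda>t. cmod (1 - cis t) / (1 + \<delta> * Re (1 - cis t))) has_integral
    2 / (\<delta> * \<beta>) * (ln (\<beta> + 1) - ln (\<beta> - 1))) {0..2 * pi}"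
proof -
  have \<beta>1: "\<beta> > 1" using \<delta> by (simp add: \<beta>_def)
  have \<beta>2: "\<beta>\<^sup>2 = 1 + 1 / (2 * \<delta>)" using \<delta> by (simp add: \<beta>_def)
  define G where "G t = - 1 / (\<delta> * \<beta>) * (ln (\<beta> + cos (t / 2)) - ln (\<beta> - cos (t / 2)))" for t
  have "((\<lambda>t. cmod (1 - cis t) / (1 + \<delta> * Re (1 - cis t))) has_integral G (2 * pi) - G 0) {0..2 * pi}"
  proof (rule fundamental_theorem_of_calculus)
    fix t :: real assume t: "t \<in> {0..2 * pi}"
    let ?c = "cos (t / 2)" and ?s = "sin (t / 2)"
    have s: "?s \<ge> 0" using t by (intro sin_ge_zero) auto
    have sc: "?s\<^sup>2 = 1 - ?c\<^sup>2" by (simp add: sin_squared_eq)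
    have Re: "Re (1 - cis t) = 2 * ?s\<^sup>2" using cos_double_sin[of "t / 2"] by simp
    have "(cmod (1 - cis t))\<^sup>2 = 2 * Re (1 - cis t)"
      unfolding cmod_power2 using sin_cos_squared_add[of t] by (simp add: power2_eq_square algebra_simps)
    then have "(cmod (1 - cis t))\<^sup>2 = (2 * ?s)\<^sup>2" unfolding Re by (simp add: power_mult_distrib)
    then have norm: "cmod (1 - cis t) = 2 * ?s" by (rule power2_eq_imp_eq) (use s in auto)
    have c: "\<beta> + ?c > 0" "\<beta> - ?c > 0"
      using \<beta>1 cos_le_one[of "t / 2"] cos_ge_minus_one[of "t / 2"] by linarith+
    have denom: "1 + \<delta> * Re (1 - cis t) = 2 * \<delta> * ((\<beta> + ?c) * (\<beta> - ?c))"
    proof -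
      have "(\<beta> + ?c) * (\<beta> - ?c) = \<beta>\<^sup>2 - ?c\<^sup>2" by (simp add: power2_eq_square algebra_simps)
      then show ?thesis unfolding Re sc \<beta>2 using \<delta> by (simp add: field_simps)
    qed
    have "(G has_real_derivative
      - 1 / (\<delta> * \<beta>) * ((- ?s * (1 / 2)) / (\<beta> + ?c) - (?s * (1 / 2)) / (\<beta> - ?c))) (at t within {0..2 * pi})"
      unfolding G_def
      by (rule DERIV_cmult) (use c in \<open>auto intro!: derivative_eq_intros simp: mult.commute\<close>)
    also have "- 1 / (\<delta> * \<beta>) * ((- ?s * (1 / 2)) / (\<beta> + ?c) - (?s * (1 / 2)) / (\<beta> - ?c)) =
        2 * ?s / (2 * \<delta> * ((\<beta> + ?c) * (\<beta> - ?c)))"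
    proof -
      have "(- ?s * (1 / 2)) / (\<beta> + ?c) - (?s * (1 / 2)) / (\<beta> - ?c) = - ?s * \<beta> / ((\<beta> + ?c) * (\<beta> - ?c))"
        using c by (simp add: divide_simps) (simp add: algebra_simps)
      then show ?thesis using \<delta> \<beta>1 by simp
    qed
    finally show "(G has_vector_derivative cmod (1 - cis t) / (1 + \<delta> * Re (1 - cis t))) (at t within {0..2 * pi})"
      unfolding has_real_derivative_iff_has_vector_derivative[symmetric] norm denom .
  qed simp
  also have "G (2 * pi) - G 0 = 2 / (\<delta> * \<beta>) * (ln (\<beta> + 1) - ln (\<beta> - 1))"
    by (simp add: G_def algebra_simps)
  finally show ?thesis .
qed

lemma circle_integral_bound:
  fixes \<delta> :: real
  assumes \<delta>: "\<delta> > 0"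
  obtains I where "((\<lambda>t. cmod (1 - cis t) / (1 + \<delta> * Re (1 - cis t))) has_integral I) {0..2 * pi}"
    and "I / (2 * pi) \<le> 1 / (2 * \<delta>) * (1 + log_plus (pi * \<delta>))"
proof
  define \<beta> where "\<beta> = sqrt (1 + 1 / (2 * \<delta>))"
  have \<beta>: "\<beta> > 1" "\<beta>\<^sup>2 = 1 + 1 / (2 * \<delta>)" using \<delta> by (simp_all add: \<beta>_def)
  show "((\<lambda>t. cmod (1 - cis t) / (1 + \<delta> * Re (1 - cis t))) has_integral
    2 / (\<delta> * \<beta>) * (ln (\<beta> + 1) - ln (\<beta> - 1))) {0..2 * pi}"
    unfolding \<beta>_def by (rule has_integral_circle[OF \<delta>])
  have "2 / (\<delta> * \<beta>) * (ln (\<beta> + 1) - ln (\<beta> - 1)) / (2 * pi) =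
      1 / (2 * \<delta>) * (2 / (pi * \<beta>) * (ln (\<beta> + 1) - ln (\<beta> - 1)))"
    using \<delta> \<beta> by simp
  also have "\<dots> \<le> 1 / (2 * \<delta>) * (1 + log_plus (pi * \<delta>))"
    using \<delta> by (intro mult_left_mono kolmogorov_constant_bound \<beta>) auto
  finally show "2 / (\<delta> * \<beta>) * (ln (\<beta> + 1) - ln (\<beta> - 1)) / (2 * pi) \<le> 1 / (2 * \<delta>) * (1 + log_plus (pi * \<delta>))" .
qed

subsection \<open>Stein factors from a lower bound on the drift\<close>

lemma cp_rate_eq_sum:
  assumes "\<And>j. j > J \<Longrightarrow> lam j = 0"
  shows "cp_rate lam = (\<Sum>j=1..J. lam j)"
proof -
  have "cp_rate lam = (\<Sum>j<J. lam (Suc j))"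
    unfolding cp_rate_def using assms by (intro suminf_finite) auto
  also have "\<dots> = (\<Sum>j=1..J. lam j)"
    by (simp add: lessThan_atLeast0 sum.atLeast_Suc_atMost_Suc_shift atLeastLessThanSuc_atLeastAtMost
        sum.shift_bounds_Suc_ivl[symmetric] flip: atLeastLessThanSuc_atLeastAtMost)
  finally show ?thesis .
qed

lemma fps_nth_of_real_power:
  "fps_nth (Abs_fps (\<lambda>i. of_real (f i) :: 'a :: real_algebra_1) ^ n) i = of_real (fps_nth (Abs_fps f ^ n) i)"
  by (induction n arbitrary: i) (auto simp: fps_mult_nth)

text \<open>\<open>L\<close> equals \<open>- cp_rate lam\<close> plus \<open>cp_rate lam\<close>
  times the generating function of one jump. The latter vanishes at 0, so the exponential series may
  be composed with it, and the coefficients are those of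
  \<open>pmf_compound_poisson\<close>.\<close>

lemma exp_cp_exponent_fps:
  assumes params: "cp_params lam" and supp: "\<And>j. j > J \<Longrightarrow> lam j = 0"
  shows "(\<lambda>z. exp (cp_exponent lam J z)) has_fps_expansion
    Abs_fps (\<lambda>i. of_real (pmf (compound_poisson_pmf lam) i))"
proof -
  let ?l = "cp_rate lam"
  have pos: "?l > 0" using params by (simp add: cp_params_def cp_rate_def)
  define p :: "complex fps" where "p = (\<Sum>j=1..J. fps_const (of_real (lam j / ?l)) * fps_X ^ j)"
  define P where "P z = (\<Sum>j=1..J. of_real (lam j / ?l) * z ^ j)" for z :: complex
  have p: "p = Abs_fps (\<lambda>i. of_real (pmf (cp_jump lam) i))"
    by (auto simp: p_def fps_eq_iff fps_sum_nth pmf_cp_jump[OF params] if_distrib[of "\<lambda>x. _ * x"] supp not_le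
        cong: if_cong)
  have "(exp \<circ> (*) (of_real ?l) \<circ> P) has_fps_expansion fps_compose (fps_exp (of_real ?l)) p"
    unfolding P_def p_def
    by (intro has_fps_expansion_compose has_fps_expansion_exp[unfolded o_def[symmetric]] fps_expansion_intros)
      (auto simp: fps_sum_nth o_def intro!: fps_expansion_intros)
  then have "(\<lambda>z. of_real (exp (- ?l)) * (exp \<circ> (*) (of_real ?l) \<circ> P) z) has_fps_expansion
      fps_const (of_real (exp (- ?l))) * fps_compose (fps_exp (of_real ?l)) p"
    by (rule has_fps_expansion_cmult_left)
  also have "(\<lambda>z. of_real (exp (- ?l)) * (exp \<circ> (*) (of_real ?l) \<circ> P) z) = (\<lambda>z. exp (cp_exponent lam J z))"
  proof
    fix z
    have "of_real ?l * P z = (\<Sum>j=1..J. of_real (lam j) * z ^ j)"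
      using pos by (simp add: P_def sum_distrib_left)
    moreover have "cp_exponent lam J z = (\<Sum>j=1..J. of_real (lam j) * z ^ j) - of_real ?l"
      by (simp add: cp_exponent_def right_diff_distrib sum_subtractf cp_rate_eq_sum[OF supp])
    ultimately have "cp_exponent lam J z = - of_real ?l + of_real ?l * P z" by simp
    then show "of_real (exp (- ?l)) * (exp \<circ> (*) (of_real ?l) \<circ> P) z = exp (cp_exponent lam J z)"
      by (simp only: exp_add) (simp flip: exp_of_real)
  qed
  also have "fps_const (of_real (exp (- ?l))) * fps_compose (fps_exp (of_real ?l)) p =
      Abs_fps (\<lambda>i. of_real (pmf (compound_poisson_pmf lam) i))"
    unfolding p by (simp add: fps_eq_iff pmf_compound_poisson[OF params] fps_compose_nth fps_nth_of_real_power)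
  finally show ?thesis .
qed

text \<open>Taking real parts of the complex coefficients preserves the Stein equation, whose own
  coefficients are real. The value at 0 is the dummy value fixed in
  \<open>stein_solution\<close>.\<close>

definition stein_function :: "(nat \<Rightarrow> real) \<Rightarrow> nat \<Rightarrow> nat \<Rightarrow> nat \<Rightarrow> real" where
  "stein_function lam J y x =
     (if x = 0 then 0 else Re (fps_nth (fps_expansion (stein_kernel lam J (x - 1)) 0) y))"

text \<open>Comparison of the coefficients of \<open>z^y\<close> in
  \<open>stein_kernel_identity\<close>, after division by \<open>1 - z\<close>, gives the equation
  at \<open>x\<close>.\<close>

lemma stein_equation_stein_function:
  assumes params: "cp_params lam" and supp: "\<And>j. j > J \<Longrightarrow> lam j = 0"
  shows "stein_equation lam (\<lambda>x. if x \<le> y then 1 else 0) (stein_function lam J y)"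
proof -
  let ?U = "compound_poisson_pmf lam" and ?h = "\<lambda>x. if x \<le> y then 1 else 0 :: real"
  let ?f = "stein_function lam J y"
  define k where "k m = fps_expansion (stein_kernel lam J m) 0" for m
  have k: "stein_kernel lam J m has_fps_expansion k m" for m
    unfolding k_def by (rule has_fps_expansion_fps_expansion[of UNIV]) (auto simp: stein_kernel_holomorphic)
  have Eh: "measure_pmf.expectation ?U ?h = (\<Sum>i\<le>y. pmf ?U i)"
    by (subst integral_pmf_atMost[where n = y]) auto
  have eq: "?h x - (\<Sum>i\<le>y. pmf ?U i) = (\<Sum>j\<le>J. real j * lam j * ?f (x + j)) - real x * ?f x" for x
  proof -
    let ?A = "(\<Sum>j=1..J. fps_const (of_real (real j * lam j)) * k (x + j - 1)) - fps_const (of_nat x) * k (x - 1)"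
    have "(\<lambda>z. (1 - z) * ((\<Sum>j=1..J. of_real (real j * lam j) * stein_kernel lam J (x + j - 1) z)
        - of_nat x * stein_kernel lam J (x - 1) z)) has_fps_expansion (1 - fps_X) * ?A"
      by (intro fps_expansion_intros k)
    moreover have "(\<lambda>z. z ^ x - exp (cp_exponent lam J z)) has_fps_expansion
        fps_X ^ x - Abs_fps (\<lambda>i. of_real (pmf ?U i))"
      by (intro fps_expansion_intros exp_cp_exponent_fps params supp)
    ultimately have "(1 - fps_X) * ?A = fps_X ^ x - Abs_fps (\<lambda>i. of_real (pmf ?U i))"
      unfolding stein_kernel_identity by (rule fps_expansion_unique_complex)
    then have "fps_nth ?A y = (\<Sum>i\<le>y. fps_nth (fps_X ^ x - Abs_fps (\<lambda>i. of_real (pmf ?U i))) i)"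
      by (rule fps_nth_divide_1_minus_X)
    also have "\<dots> = of_real (?h x - (\<Sum>i\<le>y. pmf ?U i))"
      by (simp add: sum_subtractf)
    finally have "Re (fps_nth ?A y) = ?h x - (\<Sum>i\<le>y. pmf ?U i)"
      by simp
    moreover have "Re (fps_nth ?A y) =
        (\<Sum>j=1..J. real j * lam j * Re (fps_nth (k (x + j - 1)) y)) - real x * Re (fps_nth (k (x - 1)) y)"
      by (simp add: fps_sum_nth)
    moreover have "(\<Sum>j\<le>J. real j * lam j * ?f (x + j)) = (\<Sum>j=1..J. real j * lam j * Re (fps_nth (k (x + j - 1)) y))"
      by (rule sum.mono_neutral_cong_right) (auto simp: stein_function_def k_def)
    moreover have "real x * ?f x = real x * Re (fps_nth (k (x - 1)) y)"
      by (simp add: stein_function_def k_def)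
    ultimately show ?thesis by linarith
  qed
  have "(\<lambda>j. real j * lam j * ?f (x + j)) sums (\<Sum>j\<le>J. real j * lam j * ?f (x + j))" for x
    by (rule sums_finite) (auto simp: supp)
  then show ?thesis
    unfolding stein_equation_def Eh eq by (auto simp: sums_iff)
qed

lemma bounded_stein_function: "bounded (range (stein_function lam J y))"
proof -
  obtain C where C: "\<And>m z. cmod z = 1 \<Longrightarrow> cmod (stein_kernel lam J m z) \<le> C"
    using stein_kernel_bounded by blast
  have "cmod (fps_nth (fps_expansion (stein_kernel lam J m) 0) y) \<le> (C * (2 * pi)) / (2 * pi)" for m
    using has_integral_const_real[of C 0 "2 * pi"]
    by (intro norm_fps_expansion_le[where g = "\<lambda>_. C"] stein_kernel_holomorphic C) (auto simp: mult.commute)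
  then have "\<bar>stein_function lam J y x\<bar> \<le> max 0 C" for x
    using abs_Re_le_cmod[of "fps_nth (fps_expansion (stein_kernel lam J (x - 1)) 0) y"]
    by (auto simp: stein_function_def intro: order_trans le_max_iff_disj[THEN iffD2])
  then show ?thesis by (auto simp: bounded_iff)
qed

lemma stein_solution_eq:
  assumes "cp_params lam" and supp: "\<And>j. j > J \<Longrightarrow> lam j = 0"
  shows "stein_solution lam (\<lambda>x. if x \<le> y then 1 else 0) = stein_function lam J y"
  unfolding stein_solution_def
proof (rule the_equality)
  let ?h = "\<lambda>x. if x \<le> y then 1 else 0 :: real"
  show *: "stein_function lam J y 0 = 0 \<and> bounded (range (stein_function lam J y)) \<and>
      stein_equation lam ?h (stein_function lam J y)"
    using bounded_stein_function stein_equation_stein_function[of lam J y] assms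
    by (simp add: stein_function_def[of _ _ _ 0])
  fix f assume f: "f 0 = 0 \<and> bounded (range f) \<and> stein_equation lam ?h f"
  show "f = stein_function lam J y"
  proof
    fix x
    show "f x = stein_function lam J y x"
      using stein_equation_unique[of J lam f ?h "stein_function lam J y" x] supp f *
      by (cases "x = 0") auto
  qed
qed

text \<open>An increment of the solution is the real part of a Taylor coefficient of a difference of
  consecutive kernels. \<open>stein_kernel_diff_le\<close> majorizes that difference on the unit
  circle, and \<open>circle_integral_bound\<close> evaluates the mean of the majorant.\<close>

lemma M1_K_le:
  assumes params: "cp_params lam" and supp: "\<And>j. j > J \<Longrightarrow> lam j = 0" and \<delta>: "\<delta> > 0"
    and dom: "\<And>z s. cmod z = 1 \<Longrightarrow> 0 \<le> s \<Longrightarrow> s \<le> 1 \<Longrightarrow>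
      \<delta> * Re (1 - z) \<le> Re ((1 - z) * cp_drift lam J (thinned s z))"
  shows "M1_K lam \<le> ereal (1 / (2 * \<delta>) * (1 + log_plus (pi * \<delta>)))"
proof -
  obtain I where I: "((\<lambda>t. cmod (1 - cis t) / (1 + \<delta> * Re (1 - cis t))) has_integral I) {0..2 * pi}"
    and le: "I / (2 * pi) \<le> 1 / (2 * \<delta>) * (1 + log_plus (pi * \<delta>))"
    using circle_integral_bound[OF \<delta>] .
  have diff: "\<bar>stein_function lam J y (x + 1) - stein_function lam J y x\<bar> \<le> 1 / (2 * \<delta>) * (1 + log_plus (pi * \<delta>))"
    if x: "x \<ge> 1" for x y
  proof -
    obtain m where m: "x = Suc m" using x by (cases x) auto
    let ?K = "stein_kernel lam J"
    let ?d = "\<lambda>z. ?K (Suc m) z - ?K m z"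
    have "fps_expansion ?d 0 = fps_expansion (?K (Suc m)) 0 - fps_expansion (?K m) 0"
      by (intro fps_expansion_eqI fps_expansion_intros has_fps_expansion_fps_expansion[of UNIV] stein_kernel_holomorphic) auto
    then have "stein_function lam J y (x + 1) - stein_function lam J y x = Re (fps_nth (fps_expansion ?d 0) y)"
      by (simp add: stein_function_def m)
    also have "\<bar>\<dots>\<bar> \<le> cmod (fps_nth (fps_expansion ?d 0) y)"
      by (rule abs_Re_le_cmod)
    also have "\<dots> \<le> I / (2 * pi)"
      using \<delta> by (intro norm_fps_expansion_le[OF _ _ I] stein_kernel_diff_le dom holomorphic_intros
        stein_kernel_holomorphic) auto
    finally show ?thesis using le by simp
  qed
  show ?thesis
    unfolding M1_K_def
  proof (intro SUP_least)
    fix h x assume "h \<in> H_K" "x \<in> {1 :: nat..}"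
    then obtain y where "h = (\<lambda>x. if x \<le> y then 1 else 0)" and "x \<ge> 1" by (auto simp: H_K_def)
    then show "ereal \<bar>stein_solution lam h (x + 1) - stein_solution lam h x\<bar> \<le>
        ereal (1 / (2 * \<delta>) * (1 + log_plus (pi * \<delta>)))"
      using diff[of x y] stein_solution_eq[OF params supp] by simp
  qed
qed

subsection \<open>Powers of binomial generating functions\<close>

text \<open>For \<open>cmod z = 1\<close>, \<open>u = 1 - z\<close> satisfies
  \<open>u^2 = 4 x (u - 1)\<close> with real \<open>x\<close>. Hence the real parts of the powers of
  \<open>u\<close> obey a two-term recursion, and binomial expansion gives the polynomials.\<close>

lemma Re_tilted_power:
  assumes z: "cmod z = 1" and x: "x = Re (1 - z) / 2"
  shows "Re ((1 - z) * (1 - of_real s * (1 - z)) ^ 2) = 2 * x * (1 - 4 * s*(2*x-1) + 4 * s^2*(4*x^2-3*x))"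
    and "Re ((1 - z) * (1 - of_real s * (1 - z)) ^ 3) =
      2 * x * (1 - 6 * s*(2*x-1) + 12 * s^2*(4*x^2-3*x) - 8 * s^3*(x*(8*x^2-8*x+1)))"
    and "Re ((1 - z) * (1 - of_real s * (1 - z)) ^ 4) =
      2 * x * (1 - 8 * s*(2*x-1) + 24 * s^2*(4*x^2-3*x) - 32 * s^3*(x*(8*x^2-8*x+1)) + 16 * s^4*(x^2*(16*x^2-20*x+5)))"
proof -
  define u where "u = 1 - z"
  define N where "N n = Re (u ^ n)" for n
  have N01: "N 0 = 1" "N 1 = 2 * x" using x by (simp_all add: N_def u_def)
  have u2: "u ^ 2 = of_real (4 * x) * (u - 1)"
    using z unfolding cmod_def u_def x complex_eq_iff by (simp add: power2_eq_square algebra_simps)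
  have "u ^ (n + 2) = of_real (4 * x) * (u ^ (n + 1) - u ^ n)" for n
    unfolding power_add[of u n 2] u2 by (simp add: algebra_simps)
  then have N: "N (n + 2) = 4 * x * (N (n + 1) - N n)" for n
    unfolding N_def by simp
  have "N 2 = 4 * x * (N 1 - N 0)" "N 3 = 4 * x * (N 2 - N 1)" "N 4 = 4 * x * (N 3 - N 2)" "N 5 = 4 * x * (N 4 - N 3)"
    using N[of 0] N[of 1] N[of 2] N[of 3] by (simp_all add: numeral_eq_Suc)
  note N' = this N01
  have e2: "u * (1 - of_real s * u) ^ 2 = u ^ 1 - (2 * s) *\<^sub>R u ^ 2 + s\<^sup>2 *\<^sub>R u ^ 3"
    by (simp add: scaleR_conv_of_real numeral_eq_Suc algebra_simps)
  have "Re (u * (1 - of_real s * u) ^ 2) = N 1 - 2 * s * N 2 + s\<^sup>2 * N 3"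
    unfolding e2 N_def by simp
  then show "Re ((1 - z) * (1 - of_real s * (1 - z)) ^ 2) = 2 * x * (1 - 4 * s*(2*x-1) + 4 * s^2*(4*x^2-3*x))"
    unfolding u_def[symmetric] N' by (simp add: numeral_eq_Suc algebra_simps)
  have e3: "u * (1 - of_real s * u) ^ 3 = u ^ 1 - (3 * s) *\<^sub>R u ^ 2 + (3 * s\<^sup>2) *\<^sub>R u ^ 3 - (s ^ 3) *\<^sub>R u ^ 4"
    by (simp add: scaleR_conv_of_real numeral_eq_Suc algebra_simps)
  have "Re (u * (1 - of_real s * u) ^ 3) = N 1 - 3 * s * N 2 + 3 * s\<^sup>2 * N 3 - s ^ 3 * N 4"
    unfolding e3 N_def by simp
  then show "Re ((1 - z) * (1 - of_real s * (1 - z)) ^ 3) =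
      2 * x * (1 - 6 * s*(2*x-1) + 12 * s^2*(4*x^2-3*x) - 8 * s^3*(x*(8*x^2-8*x+1)))"
    unfolding u_def[symmetric] N' by (simp add: numeral_eq_Suc algebra_simps)
  have e4: "u * (1 - of_real s * u) ^ 4 = u ^ 1 - (4 * s) *\<^sub>R u ^ 2 + (6 * s\<^sup>2) *\<^sub>R u ^ 3 - (4 * s ^ 3) *\<^sub>R u ^ 4 + (s ^ 4) *\<^sub>R u ^ 5"
    by (simp add: scaleR_conv_of_real numeral_eq_Suc algebra_simps)
  have "Re (u * (1 - of_real s * u) ^ 4) = N 1 - 4 * s * N 2 + 6 * s\<^sup>2 * N 3 - 4 * s ^ 3 * N 4 + s ^ 4 * N 5"
    unfolding e4 N_def by simp
  then show "Re ((1 - z) * (1 - of_real s * (1 - z)) ^ 4) =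
      2 * x * (1 - 8 * s*(2*x-1) + 24 * s^2*(4*x^2-3*x) - 32 * s^3*(x*(8*x^2-8*x+1)) + 16 * s^4*(x^2*(16*x^2-20*x+5)))"
    unfolding u_def[symmetric] N' by (simp add: numeral_eq_Suc algebra_simps)
qed

text \<open>The left side is the value of the right side at \<open>x = 1\<close>, that is
  \<open>z = -1\<close>; so the difference has the factor \<open>1 - x\<close>, and the cofactor
  must be nonnegative. The cubic case works in the same way.\<close>

lemma tilted_quadratic_ge:
  fixes x s :: real
  assumes "0 \<le> x" "x \<le> 1" "0 \<le> s" "s \<le> 1/4"
  shows "(1 - 2 * s)^2 \<le> 1 - 4 * s*(2*x-1) + 4 * s^2*(4*x^2-3*x)"
proof -
  have "s * (4*x+1) \<le> (1/4) * 5" using assms by (intro mult_mono) auto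
  then have "0 \<le> (1 - x) * (4 * s) * (2 - s*(4*x+1))" using assms by (intro mult_nonneg_nonneg) auto
  also have "\<dots> = 1 - 4 * s*(2*x-1) + 4 * s^2*(4*x^2-3*x) - (1 - 2 * s)^2"
    by (simp add: numeral_eq_Suc algebra_simps)
  finally show ?thesis by simp
qed

lemma tilted_cubic_ge:
  fixes x s :: real
  assumes "0 \<le> x" "x \<le> 1" "0 \<le> s" "s \<le> 1/4"
  shows "(1 - 2 * s)^3 \<le> 1 - 6 * s*(2*x-1) + 12 * s^2*(4*x^2-3*x) - 8 * s^3*(x*(8*x^2-8*x+1))"
proof -
  define t where "t = s * x"
  have t: "0 \<le> t" "t \<le> 1/4" using assms mult_mono[of s "1/4" x 1] by (auto simp: t_def)
  \<comment> \<open>Sixteen times this product is \<open>2 - 12*t + 16*t^2\<close>; the remaining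
    \<open>1 - 3 * s\<close> is positive.\<close>
  have "0 \<le> (1/4 - t) * (1/2 - t)" using t by (intro mult_nonneg_nonneg) auto
  then have "0 \<le> 3 - 3 * s - 12*t + 16*t^2"
    using assms by (simp add: algebra_simps power2_eq_square)
  then have "0 \<le> 3 - 3 * s - 12*t + 16*t^2 + 2 * s^2" by simp
  then have "0 \<le> (1 - x) * (4 * s) * (3 - 3 * s - 12*t + 16*t^2 + 2 * s^2)" using assms by (intro mult_nonneg_nonneg) auto
  also have "\<dots> = 1 - 6 * s*(2*x-1) + 12 * s^2*(4*x^2-3*x) - 8 * s^3*(x*(8*x^2-8*x+1)) - (1 - 2 * s)^3"
    by (simp add: t_def numeral_eq_Suc algebra_simps)
  finally show ?thesis by simp
qed

text \<open>The left side is \<open>(1 - 2 * s)^4 - 16 * s^4\<close>, lying \<open>16 * s^4\<close>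
  below the value at \<open>x = 1\<close>. Subtracting \<open>16 * s^4 * x^2\<close> from the
  difference of the sides leaves a multiple of \<open>1 - x\<close>, with cofactor
  \<open>8 * s * ?B\<close>.\<close>

lemma tilted_quartic_ge:
  fixes x s :: real
  assumes "0 \<le> x" "x \<le> 1" "0 \<le> s" "s \<le> 1/4"
  shows "(1 - 4 * s)*(1 - 4 * s + 8 * s^2) \<le> 1 - 8 * s*(2*x-1) + 24 * s^2*(4*x^2-3*x) - 32 * s^3*(x*(8*x^2-8*x+1)) + 16 * s^4*(x^2*(16*x^2-20*x+5))"
proof -
  define t where "t = s * x"
  have t: "0 \<le> t" "t \<le> 1/4" using assms mult_mono[of s "1/4" x 1] by (auto simp: t_def)
  have t2: "t^2 \<le> 1/16" using t mult_mono[of t "1/4" t "1/4"] by (simp add: power2_eq_square)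
  let ?B = "2 - 12*t - 3 * s + 32*t^2 + 4 * s^2 + 8 * s*t^2 - 32*t^3"
  have "0 \<le> (1/4 - s) * (2 - 4 * s - 8*t^2)" using assms t2 by (intro mult_nonneg_nonneg) auto
  moreover have "0 \<le> (1/4 - t) * ((1/4 - t) * (18 - 32 * t))" using t by (intro mult_nonneg_nonneg) auto
  moreover have "?B = (1/4 - s) * (2 - 4 * s - 8*t^2) + (3/2 - 12*t + 34*t^2 - 32*t^3)"
    by (simp add: numeral_eq_Suc algebra_simps)
  moreover have "3/2 - 12*t + 34*t^2 - 32*t^3 = (1/4 - t) * ((1/4 - t) * (18 - 32 * t)) + (3/8 - t)"
    by (simp add: numeral_eq_Suc field_simps)
  ultimately have "0 \<le> ?B" using t by linarith
  then have "0 \<le> (1 - x) * (8 * s) * ?B + 16 * s^4*x^2" using assms by (intro add_nonneg_nonneg mult_nonneg_nonneg) auto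
  also have "\<dots> = 1 - 8 * s*(2*x-1) + 24 * s^2*(4*x^2-3*x) - 32 * s^3*(x*(8*x^2-8*x+1)) + 16 * s^4*(x^2*(16*x^2-20*x+5))
      - (1 - 4 * s)*(1 - 4 * s + 8 * s^2)"
    by (simp add: t_def numeral_eq_Suc algebra_simps)
  finally show ?thesis by simp
qed

text \<open>The shift to \<open>j - 1\<close> matches the power of \<open>w\<close> attached to
  \<open>j * lam j\<close> in the drift, so each binomial law contributes one power of
  \<open>1 - y (1 - w)\<close>.\<close>

lemma binomial_pgf:
  fixes w :: complex
  assumes y: "0 \<le> y" "y \<le> 1" and "m < n"
  shows "(\<Sum>j=1..n. of_real (pmf (binomial_pmf m y) (j - 1)) * w ^ (j - 1)) = (1 - of_real y * (1 - w)) ^ m"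
proof -
  have "(\<Sum>j=1..n. of_real (pmf (binomial_pmf m y) (j - 1)) * w ^ (j - 1)) =
      (\<Sum>i<n. of_real (pmf (binomial_pmf m y) i) * w ^ i)"
    by (rule sum.reindex_bij_witness[of _ Suc "\<lambda>j. j - 1"]) auto
  also have "\<dots> = (\<Sum>i\<le>m. of_real (pmf (binomial_pmf m y) i) * w ^ i)"
    using \<open>m < n\<close> y by (intro sum.mono_neutral_right) auto
  also have "\<dots> = (of_real y * w + of_real (1 - y)) ^ m"
    using y by (simp add: binomial_ring power_mult_distrib mult_ac)
  also have "of_real y * w + of_real (1 - y) = 1 - of_real y * (1 - w)"
    by (simp add: algebra_simps)
  finally show ?thesis .
qed

text \<open>The lower bounds decrease in \<open>s\<close> on \<open>[0, 1/4]\<close>, so those at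
  the endpoint \<open>y\<close> hold for every smaller \<open>s\<close>. This makes the drift bound
  uniform along the segment.\<close>

lemma Re_tilted_power_ge:
  assumes z: "cmod z = 1" and s: "0 \<le> s" "s \<le> y" "y \<le> 1 / 4"
  shows "Re (1 - z) * (1 - 2 * y)\<^sup>2 \<le> Re ((1 - z) * (1 - of_real s * (1 - z)) ^ 2)"
    and "Re (1 - z) * (1 - 2 * y) ^ 3 \<le> Re ((1 - z) * (1 - of_real s * (1 - z)) ^ 3)"
    and "Re (1 - z) * ((1 - 4 * y) * (1 - 4 * y + 8 * y\<^sup>2)) \<le> Re ((1 - z) * (1 - of_real s * (1 - z)) ^ 4)"
proof -
  define x where "x = Re (1 - z) / 2"
  have x: "0 \<le> x" "x \<le> 1" and R: "Re (1 - z) = 2 * x"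
    using abs_Re_le_cmod[of z] z by (auto simp: x_def)
  have s': "0 \<le> s" "s \<le> 1 / 4" using s by auto
  have "(1 - 2 * y)\<^sup>2 \<le> (1 - 2 * s)\<^sup>2" using s by (intro power_mono) auto
  with tilted_quadratic_ge[OF x s']
  show "Re (1 - z) * (1 - 2 * y)\<^sup>2 \<le> Re ((1 - z) * (1 - of_real s * (1 - z)) ^ 2)"
    unfolding Re_tilted_power[OF z x_def] R using x by (intro mult_left_mono) auto
  have "(1 - 2 * y) ^ 3 \<le> (1 - 2 * s) ^ 3" using s by (intro power_mono) auto
  with tilted_cubic_ge[OF x s']
  show "Re (1 - z) * (1 - 2 * y) ^ 3 \<le> Re ((1 - z) * (1 - of_real s * (1 - z)) ^ 3)"
    unfolding Re_tilted_power[OF z x_def] R using x by (intro mult_left_mono) auto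
  have "0 \<le> (y - s) * (4 - 8 * (y + s))" using s by (intro mult_nonneg_nonneg) auto
  then have "1 - 4 * y + 8 * y\<^sup>2 \<le> 1 - 4 * s + 8 * s\<^sup>2"
    by (simp add: power2_eq_square algebra_simps)
  moreover have "0 \<le> 1 - 4 * y + 8 * y\<^sup>2" using s by (simp add: add_nonneg_nonneg)
  ultimately have "(1 - 4 * y) * (1 - 4 * y + 8 * y\<^sup>2) \<le> (1 - 4 * s) * (1 - 4 * s + 8 * s\<^sup>2)"
    using s by (intro mult_mono) auto
  with tilted_quartic_ge[OF x s']
  show "Re (1 - z) * ((1 - 4 * y) * (1 - 4 * y + 8 * y\<^sup>2)) \<le> Re ((1 - z) * (1 - of_real s * (1 - z)) ^ 4)"
    unfolding Re_tilted_power[OF z x_def] R using x by (intro mult_left_mono) auto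
qed

section \<open>Positivity and drift of the given parameters\<close>

theorem proposition4:
  fixes k n :: nat
    and q psi delta :: real
    and bin_prob :: "nat \<Rightarrow> nat \<Rightarrow> real"
    and lam :: "nat \<Rightarrow> real"
    and a b c :: "real \<Rightarrow> real"
  assumes "k \<ge> 1" and "n \<ge> k + 1"
    and "0 < q" and "q < 1"
    and "psi = q ^ (k ^ 2)"
    and "\<And>i j. i \<in> {1, 2, 3} \<Longrightarrow> j \<ge> 1 \<Longrightarrow> bin_prob i j = pmf (binomial_pmf (i + 1) (q ^ k)) (j - 1)"
    and "\<And>j :: nat. 1 \<le> j \<Longrightarrow> j \<le> 5 \<Longrightarrow>
           lam j = 1 / real j * psi *
             (4 * bin_prob 1 j + 4 * real (n - k - 1) * bin_prob 2 j + (real (n - k - 1))\<^sup>2 * bin_prob 3 j)"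
    and "\<And>j. j \<ge> 6 \<Longrightarrow> lam j = 0"
    and "\<And>y :: real. a y = (1 - 2 * y)\<^sup>2"
    and "\<And>y :: real. b y = (1 - 2 * y) ^ 3"
    and "\<And>y :: real. c y = (1 - 4 * y) * (1 - 4 * y + 8 * y\<^sup>2)"
    and "delta = psi * (4 * a (q ^ k) + 4 * real (n - k - 1) * b (q ^ k)
                        + (real (n - k - 1))\<^sup>2 * c (q ^ k))"
    and "q ^ k < 1 / 4"
  shows "M1_K lam \<le> ereal (1 / (2 * delta) * (1 + log_plus (pi * delta)))"
proof -
  note bin = assms(6) and lam = assms(7) and supp = assms(8)
  define y N where "y = q ^ k" and "N = real (n - k - 1)"
  let ?p = "\<lambda>i j. pmf (binomial_pmf i y) (j - 1)"
  have y: "0 < y" "y < 1 / 4" "y \<le> 1" using assms(3,13) by (auto simp: y_def)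
  have psi: "psi > 0" using assms(3,5) by simp
  have N: "N \<ge> 0" by (simp add: N_def)
  have lam_eq: "real j * lam j = psi * (4 * ?p 2 j + 4 * N * ?p 3 j + N\<^sup>2 * ?p 4 j)" if "j \<in> {1..5}" for j
    using that lam[of j] bin[of 1 j] bin[of 2 j] bin[of 3 j] by (simp add: y_def N_def flip: numeral_2_eq_2)
  have lam_nonneg: "lam j \<ge> 0" if "j \<ge> 1" for j
  proof (cases "j \<le> 5")
    case True
    have "real j * lam j \<ge> 0"
      using lam_eq[of j] True that psi N by simp
    then show ?thesis using that by (simp add: zero_le_mult_iff)
  qed (simp add: supp)
  \<comment> \<open>The first binomial law has mass \<open>(1 - y)^2\<close> at 0, so this holds
    even when \<open>n = k + 1\<close> and \<open>N = 0\<close>.\<close>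
  have "lam 1 > 0"
    using lam_eq[of 1] psi N y by (simp add: add_pos_nonneg)
  moreover have "lam 1 \<le> (\<Sum>j=1..5. lam j)"
    using lam_nonneg by (intro member_le_sum) auto
  ultimately have "cp_rate lam > 0"
    using cp_rate_eq_sum[of 5 lam] supp by simp
  moreover have "summable (\<lambda>j. lam (Suc j))"
    using supp by (intro summable_finite[of "{..<5}"]) auto
  ultimately have params: "cp_params lam"
    using lam_nonneg by (simp add: cp_params_def cp_rate_def)
  have a: "a y = (1 - 2 * y)\<^sup>2" and b: "b y = (1 - 2 * y) ^ 3"
    and c: "c y = (1 - 4 * y) * (1 - 4 * y + 8 * y\<^sup>2)" by (simp_all add: assms(9-11))
  have delta: "delta = psi * (4 * a y + 4 * N * b y + N\<^sup>2 * c y)"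
    by (simp add: assms(12) y_def N_def)
  have "a y > 0" "b y \<ge> 0" "c y \<ge> 0" using y by (simp_all add: a b c add_nonneg_nonneg)
  then have delta_pos: "delta > 0"
    using psi N by (simp add: delta add_pos_nonneg)
  have drift: "cp_drift lam 5 w = of_real psi * (4 * (1 - of_real y * (1 - w)) ^ 2 +
      of_real (4 * N) * (1 - of_real y * (1 - w)) ^ 3 + of_real (N\<^sup>2) * (1 - of_real y * (1 - w)) ^ 4)" for w
  proof -
    note pgf = binomial_pgf[OF less_imp_le[OF y(1)] y(3), of _ 5 w]
    have lt: "2 < (5 :: nat)" "3 < (5 :: nat)" "4 < (5 :: nat)" by simp_all
    have "cp_drift lam 5 w = (\<Sum>j=1..5. of_real psi * (4 * (of_real (?p 2 j) * w ^ (j - 1)) +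
        of_real (4 * N) * (of_real (?p 3 j) * w ^ (j - 1)) + of_real (N\<^sup>2) * (of_real (?p 4 j) * w ^ (j - 1))))"
      unfolding cp_drift_def by (intro sum.cong refl, subst lam_eq) (simp_all add: algebra_simps)
    also have "\<dots> = of_real psi * (4 * (\<Sum>j=1..5. of_real (?p 2 j) * w ^ (j - 1)) +
        of_real (4 * N) * (\<Sum>j=1..5. of_real (?p 3 j) * w ^ (j - 1)) +
        of_real (N\<^sup>2) * (\<Sum>j=1..5. of_real (?p 4 j) * w ^ (j - 1)))"
      by (simp only: sum.distrib flip: sum_distrib_left)
    finally show ?thesis
      unfolding pgf[OF lt(1)] pgf[OF lt(2)] pgf[OF lt(3)] .
  qed
  show ?thesis
  proof (rule M1_K_le[OF params _ delta_pos])
    show "lam j = 0" if "j > 5" for j using supp that by simp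
    fix z :: complex and s :: real assume z: "cmod z = 1" and s: "0 \<le> s" "s \<le> 1"
    let ?w = "1 - of_real (y * s) * (1 - z)"
    have "y * s \<le> y" using y s by (simp add: mult_left_le)
    note ge = Re_tilted_power_ge[OF z _ this, folded a b c]
    have "delta * Re (1 - z) = psi * (4 * (Re (1 - z) * a y) + 4 * N * (Re (1 - z) * b y) + N\<^sup>2 * (Re (1 - z) * c y))"
      by (simp add: delta algebra_simps)
    also have "\<dots> \<le> psi * (4 * Re ((1 - z) * ?w ^ 2) + 4 * N * Re ((1 - z) * ?w ^ 3) + N\<^sup>2 * Re ((1 - z) * ?w ^ 4))"
      using psi N y s by (intro mult_left_mono add_mono ge) auto
    also have "\<dots> = Re (psi *\<^sub>R (4 *\<^sub>R ((1 - z) * ?w ^ 2) + (4 * N) *\<^sub>R ((1 - z) * ?w ^ 3) + N\<^sup>2 *\<^sub>R ((1 - z) * ?w ^ 4)))"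
      by (simp only: scaleR_complex.sel plus_complex.sel)
    also have "psi *\<^sub>R (4 *\<^sub>R ((1 - z) * ?w ^ 2) + (4 * N) *\<^sub>R ((1 - z) * ?w ^ 3) + N\<^sup>2 *\<^sub>R ((1 - z) * ?w ^ 4)) =
        (1 - z) * cp_drift lam 5 (thinned s z)"
    proof -
      define v where "v = ?w"
      \<comment> \<open>Thinnings compose: parameter \<open>y\<close> after parameter
        \<open>s\<close> is parameter \<open>y * s\<close>, which lies in
        \<open>[0, y]\<close>.\<close>
      have w: "1 - of_real y * (1 - thinned s z) = v" by (simp add: thinned_def v_def)
      show ?thesis
        unfolding drift w unfolding v_def[symmetric] by (simp add: scaleR_conv_of_real algebra_simps)
    qed
    finally show "delta * Re (1 - z) \<le> Re ((1 - z) * cp_drift lam 5 (thinned s z))" .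
  qed
qed

end
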